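(* Let $k\ge 1$ be an integer and let $B$ be a real number. Every solution $(z_n)_{n\ge 0}$ of $$z_{n+k}=\frac{z_n}{-1+Bz_n},\qquad n\ge 0,$$ is $2k$-periodic and contains two cycles of length $k$.
   Context: A solution is a real sequence $(z_n)_{n\ge 0}$ satisfying the recurrence for all $n\ge 0$ with all denominators $-1+Bz_n$ nonzero. A sequence is $2k$-periodic if $z_{n+2k}=z_n$ for all $n\ge 0$. "Contains two cycles of length $k$" means that a period of length $2k$ is made of two consecutive blocks of length $k$, namely $z_0,\dots,z_{k-1}$ followed by $\frac{z_0}{-1+Bz_0},\dots,\frac{z_{k-1}}{-1+Bz_{k-1}}$. *)

theory Defs
  imports Complex_Main
begin

text \<open>Since division by zero is total in HOL, the requirement that the denominators
  do not vanish is an explicit part of being a solution.\<close>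

definition is_solution :: "nat \<Rightarrow> real \<Rightarrow> (nat \<Rightarrow> real) \<Rightarrow> bool" where
  "is_solution k B z \<longleftrightarrow>
     (\<forall>n. -1 + B * z n \<noteq> 0 \<and> z (n + k) = z n / (-1 + B * z n))"

text \<open>The number \<open>p\<close> is a period, not necessarily the least one.\<close>

definition periodic_seq :: "nat \<Rightarrow> (nat \<Rightarrow> real) \<Rightarrow> bool" where
  "periodic_seq p z \<longleftrightarrow> (\<forall>n. z (n + p) = z n)"

definition contains_two_cycles :: "nat \<Rightarrow> real \<Rightarrow> (nat \<Rightarrow> real) \<Rightarrow> bool" where
  "contains_two_cycles k B z \<longleftrightarrow>
     periodic_seq (2 * k) z \<and>
     map z [0..<2 * k] =
       map z [0..<k] @ map (\<lambda>i. z i / (-1 + B * z i)) [0..<k]"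

end

theory Submission
  imports Defs
begin

text \<open>The recurrence applies the Moebius map \<open>x \<mapsto> x / (-1 + B * x)\<close> along steps of length \<open>k\<close>.
  Its matrix has trace zero, so the map is an involution wherever its denominator does not vanish.
  Two steps therefore return to the starting value, which is periodicity with period \<open>2 * k\<close>, and
  one step carries the first block of length \<open>k\<close> to the second.\<close>

text \<open>The denominator at the image point is the reciprocal of the original one, since
  \<open>-1 + B * (x / (-1 + B * x)) = 1 / (-1 + B * x)\<close>; the two factors cancel.\<close>

lemma moebius_involution:
  fixes B x :: "'a :: field"
  assumes "-1 + B * x \<noteq> 0"
  shows "(x / (-1 + B * x)) / (-1 + B * (x / (-1 + B * x))) = x"
proof -
  have "-1 + B * (x / (-1 + B * x)) = 1 / (-1 + B * x)"
    using assms by (simp add: divide_simps)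
  then show ?thesis
    using assms by simp
qed

lemma solution_periodic:
  assumes "is_solution k B z"
  shows "periodic_seq (2 * k) z"
  unfolding periodic_seq_def
proof
  fix n
  have step: "z (m + k) = z m / (-1 + B * z m)" and nz: "-1 + B * z m \<noteq> 0" for m
    using assms unfolding is_solution_def by blast+
  have "z (n + 2 * k) = z ((n + k) + k)"
    by (simp add: mult_2 add.assoc)
  also have "\<dots> = z n"
    using moebius_involution[OF nz] by (simp only: step)
  finally show "z (n + 2 * k) = z n" .
qed

theorem theorem2p3:
  fixes k :: nat and B :: real and z :: "nat \<Rightarrow> real"
  assumes "k \<ge> 1" and "is_solution k B z"
  shows "periodic_seq (2 * k) z \<and> contains_two_cycles k B z"
proof -
  have step: "z (i + k) = z i / (-1 + B * z i)" for i
    using assms(2) unfolding is_solution_def by blast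
  have "map z [0..<2 * k] = map z [0..<k] @ map z [k..<k + k]"
    using upt_add_eq_append[of 0 k k] by (simp add: mult_2)
  also have "map z [k..<k + k] = map (\<lambda>i. z (i + k)) [0..<k]"
    by (rule nth_equalityI) (simp_all add: add.commute)
  also have "\<dots> = map (\<lambda>i. z i / (-1 + B * z i)) [0..<k]"
    by (simp only: step)
  finally show ?thesis
    using solution_periodic[OF assms(2)] unfolding contains_two_cycles_def by blast
qed

end
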